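(* Let $s\ge 1$ be an integer. For every integer $r\ge 1$, the average value over $k$ of $$\frac{1}{k^{s(r+1)}}\sum_{j=1}^{k^s}j^r c_k^{(s)}(j),$$ that is, the limit $$\lim_{x\to\infty}\frac{1}{x}\sum_{1\le k\le x}\left(\frac{1}{k^{s(r+1)}}\sum_{j=1}^{k^s}j^r c_k^{(s)}(j)\right),$$ is positive.
   Context: For positive integers $a,b,s$, the generalized GCD $(a,b)_s$ is the largest $d^s$ with $d\in\mathbb{N}$ such that $d^s\mid a$ and $d^s\mid b$. For positive integers $k,s$ and an integer $j$, the generalized (Cohen) Ramanujan sum is $$c_k^{(s)}(j)=\sum_{\substack{1\le m\le k^s\\ (m,k^s)_s=1}}e^{2\pi i jm/k^s}.$$ The average value over $k$ of an arithmetical function $f(k)$ means $\lim_{x\to\infty}\frac1x\sum_{k\le x}f(k)$. *)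

theory Defs
  imports Complex_Main
begin

text \<open>The generalized GCD \<open>(a, b)\<^sub>s\<close>. It is meant for positive \<open>a\<close>, \<open>b\<close>, \<open>s\<close>, where the set
  below is finite and contains 1.\<close>

definition gen_gcd :: "nat \<Rightarrow> nat \<Rightarrow> nat \<Rightarrow> nat" where
  "gen_gcd s a b = Max {d ^ s | d :: nat. d ^ s dvd a \<and> d ^ s dvd b}"

definition cohen_ramanujan_sum :: "nat \<Rightarrow> nat \<Rightarrow> int \<Rightarrow> complex" where
  "cohen_ramanujan_sum s k j =
     (\<Sum>m | 1 \<le> m \<and> m \<le> k ^ s \<and> gen_gcd s m (k ^ s) = 1.
        exp (2 * of_real pi * \<i> * of_int j * of_nat m / of_nat (k ^ s)))"

text \<open>The limit is taken over real \<open>x\<close>.\<close>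

definition has_average_value :: "(nat \<Rightarrow> 'a :: real_normed_field) \<Rightarrow> 'a \<Rightarrow> bool" where
  "has_average_value f L \<longleftrightarrow>
     ((\<lambda>x :: real. 1 / of_real x * (\<Sum>k | 1 \<le> k \<and> real k \<le> x. f k)) \<longlongrightarrow> L) at_top"

end

theory Submission
  imports
    Defs
    "HOL-Analysis.Analysis"
    "HOL-Computational_Algebra.Squarefree"
    "HOL-Real_Asymp.Real_Asymp"
begin

text \<open>
  Writing the coprimality condition in \<open>c\<^sub>k\<^sup>(\<^sup>s\<^sup>)(j)\<close> as a Moebius sum turns the weighted sum into
  \<open>\<Sum>e | k. \<mu>(e) T(e\<^sup>s)\<close> with \<open>T(N) = (1\<^sup>r + \<dots> + N\<^sup>r) / N\<^sup>r\<^sup>+\<^sup>1\<close>. Put \<open>D(N) = T(N) - 1 / (r + 1)\<close>. The constant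
  part \<open>1 / (r + 1)\<close> contributes only at \<open>k = 1\<close> and does not affect the average. A tangent line
  argument gives \<open>0 \<le> D(N) \<le> D(1) / N\<close>, so by dominated convergence the average exists and equals
  \<open>L = \<Sum>e. \<mu>(e) D(e\<^sup>s) / e\<close>. Its first term is \<open>D(1) = r / (r + 1)\<close>, and the remaining ones add up to at
  most \<open>D(1) (1/2\<^sup>2 + 1/3\<^sup>2 + \<dots>) < D(1)\<close> in absolute value, whatever the signs of \<open>\<mu>\<close>.
\<close>

section \<open>The Moebius function\<close>

definition moebius_mu :: "nat \<Rightarrow> int" where
  "moebius_mu n = (if squarefree n then (-1) ^ card (prime_factors n) else 0)"

lemma moebius_mu_1 [simp]: "moebius_mu (Suc 0) = 1"
  by (simp add: moebius_mu_def)

lemma abs_moebius_mu_le: "\<bar>moebius_mu n\<bar> \<le> 1"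
  by (simp add: moebius_mu_def power_abs)

lemma prod_prime_factors_squarefree:
  fixes n :: nat
  assumes "squarefree n"
  shows "\<Prod>(prime_factors n) = n"
proof -
  have nz: "n \<noteq> 0" using assms by (metis not_squarefree_0)
  have "(\<Prod>p\<in>prime_factors n. p) = (\<Prod>p\<in>prime_factors n. p ^ multiplicity p n)"
    using assms nz by (intro prod.cong) (auto simp: squarefree_factorial_semiring')
  also have "\<dots> = n" using nz by (simp add: prod_prime_factors)
  finally show ?thesis .
qed

lemma
  fixes X :: "nat set"
  assumes "finite X" and "\<And>p. p \<in> X \<Longrightarrow> prime p"
  shows prime_factors_Prod_primes: "prime_factors (\<Prod>X) = X"
    and squarefree_Prod_primes: "squarefree (\<Prod>X)"
proof -
  have "prime_factors (\<Prod>X) = (\<Union>p\<in>X. prime_factors p)"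
    using assms by (subst prime_factors_prod) (auto simp: o_def dest: prime_gt_0_nat)
  also have "\<dots> = X"
    using assms by (auto simp: prime_prime_factors)
  finally show "prime_factors (\<Prod>X) = X" .
  show "squarefree (\<Prod>X)"
    using assms by (intro squarefree_prod_coprime primes_coprime squarefree_prime) auto
qed

text \<open>\<open>Prod\<close> inverts \<open>prime_factors\<close> on squarefree numbers. The
  bijection turns a divisor sum of \<open>moebius_mu\<close> into an alternating sum over subsets of
  a finite set of primes.\<close>

lemma bij_betw_prime_factors_squarefree_divisors:
  fixes n :: nat
  assumes "n > 0"
  shows "bij_betw prime_factors {d. d dvd n \<and> squarefree d} (Pow (prime_factors n))"
proof (rule bij_betwI[where g = Prod])
  show "prime_factors \<in> {d. d dvd n \<and> squarefree d} \<rightarrow> Pow (prime_factors n)"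
    using assms by (auto dest!: dvd_prime_factors[rotated])
  show "Prod \<in> Pow (prime_factors n) \<rightarrow> {d. d dvd n \<and> squarefree d}"
  proof safe
    fix X assume X: "X \<subseteq> prime_factors n"
    then have fin: "finite X" by (rule finite_subset) auto
    show "squarefree (\<Prod>X)"
      using X fin by (intro squarefree_Prod_primes) auto
    have "\<Prod>X dvd (\<Prod>p\<in>X. p ^ multiplicity p n)"
      using X by (intro prod_dvd_prod) (auto simp: prime_factors_multiplicity intro!: dvd_power)
    also have "\<dots> dvd (\<Prod>p\<in>prime_factors n. p ^ multiplicity p n)"
      using X by (intro prod_dvd_prod_subset) auto
    also have "\<dots> = n" using assms by (simp add: prod_prime_factors)
    finally show "\<Prod>X dvd n" .
  qed
  show "\<Prod>(prime_factors d) = d" if "d \<in> {d. d dvd n \<and> squarefree d}" for d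
    using that by (simp add: prod_prime_factors_squarefree)
  show "prime_factors (\<Prod>X) = X" if "X \<in> Pow (prime_factors n)" for X
  proof (rule prime_factors_Prod_primes)
    show "finite X" using that by (auto intro: finite_subset)
    show "prime p" if "p \<in> X" for p using that \<open>X \<in> _\<close> by auto
  qed
qed

lemma sum_moebius_mu_divisors:
  assumes "n > 0"
  shows "(\<Sum>d | d dvd n. moebius_mu d) = (if n = 1 then 1 else 0)"
proof -
  have "(\<Sum>d | d dvd n. moebius_mu d) =
      (\<Sum>d | d dvd n \<and> squarefree d. (-1) ^ card (prime_factors d))"
    using assms by (intro sum.mono_neutral_cong_right) (auto simp: moebius_mu_def)
  also have "\<dots> = (\<Sum>X\<in>Pow (prime_factors n). (-1) ^ card X)"
    by (rule sum.reindex_bij_betw[OF bij_betw_prime_factors_squarefree_divisors[OF assms]])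
  \<comment> \<open>Expanding this product gives one signed term per subset. It is 0 as soon as
    \<open>n\<close> has a prime factor, and the empty product 1 otherwise.\<close>
  also have "\<dots> = (\<Prod>p\<in>prime_factors n. -1 + 1)"
    by (subst prod_add) auto
  also have "\<dots> = (if n = 1 then 1 else 0)"
    using assms by (auto simp: prime_factorization_empty_iff card_gt_0_iff)
  finally show ?thesis .
qed

section \<open>Cohen-Ramanujan sums\<close>

text \<open>Powers commute with \<open>gcd\<close>, hence also with \<open>lcm\<close> because the
  product of the two is \<open>a * b\<close>. This makes the set of \<open>e\<close> with
  \<open>e ^ s dvd m\<close> closed under \<open>lcm\<close>.\<close>

lemma lcm_power_dvd:
  fixes a b m :: nat
  assumes "a ^ s dvd m" and "b ^ s dvd m"
  shows "lcm a b ^ s dvd m"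
proof (cases "gcd a b = 0")
  case True
  then show ?thesis using assms by simp
next
  case False
  have "gcd a b ^ s * lcm a b ^ s = a ^ s * b ^ s"
    by (metis power_mult_distrib prod_gcd_lcm_nat)
  also have "\<dots> = gcd a b ^ s * lcm (a ^ s) (b ^ s)"
    by (metis gcd_exp prod_gcd_lcm_nat)
  finally have "lcm a b ^ s = lcm (a ^ s) (b ^ s)"
    using False by auto
  then show ?thesis using assms by (simp add: lcm_least)
qed

text \<open>The set under \<open>Max\<close> always contains 1 and is finite because
  \<open>k ^ s\<close> is positive. For positive \<open>s\<close>, moreover,
  \<open>d ^ s dvd k ^ s\<close> amounts to \<open>d dvd k\<close>.\<close>

lemma gen_gcd_eq_1_iff:
  assumes "k > 0" and "s > 0"
  shows "gen_gcd s m (k ^ s) = 1 \<longleftrightarrow> (\<forall>d. d ^ s dvd m \<and> d dvd k \<longrightarrow> d = 1)"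
proof -
  define A where "A = {d ^ s | d :: nat. d ^ s dvd m \<and> d ^ s dvd k ^ s}"
  have "A \<subseteq> {..k ^ s}"
    using assms by (auto simp: A_def simp del: pow_divides_pow_iff intro!: dvd_imp_le)
  then have fin: "finite A" by (rule finite_subset) auto
  have one: "1 \<in> A" by (auto simp: A_def intro!: exI[of _ 1])
  have "gen_gcd s m (k ^ s) = 1 \<longleftrightarrow> (\<forall>a\<in>A. a \<le> 1)"
    using fin one unfolding gen_gcd_def A_def[symmetric] by (subst Max_eq_iff) auto
  also have "\<dots> \<longleftrightarrow> (\<forall>d. d ^ s dvd m \<and> d dvd k \<longrightarrow> d ^ s \<le> 1)"
    using assms unfolding A_def by auto
  also have "\<dots> \<longleftrightarrow> (\<forall>d. d ^ s dvd m \<and> d dvd k \<longrightarrow> d = 1)"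
  proof -
    have "d ^ s \<le> 1 \<longleftrightarrow> d = 1" if "d dvd k" for d
    proof -
      have "d > 0" using that assms by (auto intro: Nat.gr0I)
      then show ?thesis using one_less_power[of d s] assms by (cases "d = 1") auto
    qed
    then show ?thesis by blast
  qed
  finally show ?thesis .
qed

text \<open>The admissible \<open>e\<close> are closed under \<open>lcm\<close> and under divisors,
  so they are exactly the divisors of the largest one, \<open>g\<close>. The usual Moebius identity
  at \<open>g\<close> then applies.\<close>

lemma sum_moebius_mu_power_divisors:
  assumes "k > 0" and "s > 0"
  shows "(\<Sum>e | e dvd k \<and> e ^ s dvd m. moebius_mu e) = (if gen_gcd s m (k ^ s) = 1 then 1 else 0)"
proof -
  define D where "D = {e. e dvd k \<and> e ^ s dvd m}"
  have fin: "finite D" using assms by (auto simp: D_def)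
  have "1 \<in> D" by (simp add: D_def)
  define g where "g = Max D"
  have gD: "g \<in> D" unfolding g_def using fin \<open>1 \<in> D\<close> by (intro Max_in) auto
  then have g0: "g > 0" using assms by (auto simp: D_def intro: Nat.gr0I)
  have D_eq: "D = {e. e dvd g}"
  proof safe
    fix e assume e: "e \<in> D"
    then have "lcm e g \<in> D" using gD by (auto simp: D_def intro: lcm_power_dvd)
    then have "lcm e g \<le> g" unfolding g_def using fin by (intro Max_ge)
    moreover have "g \<le> lcm e g" 
      using \<open>lcm e g \<in> D\<close> assms by (intro dvd_imp_le) (auto simp: D_def intro!: Nat.gr0I)
    ultimately show "e dvd g" by (metis dvd_lcm1 le_antisym)
  next
    fix e assume "e dvd g"
    then show "e \<in> D"
      using gD by (auto simp: D_def intro: dvd_trans dvd_power_same)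
  qed
  have "gen_gcd s m (k ^ s) = 1 \<longleftrightarrow> (\<forall>e\<in>D. e = 1)"
    using gen_gcd_eq_1_iff[OF assms] by (auto simp: D_def)
  then have "gen_gcd s m (k ^ s) = 1 \<longleftrightarrow> g = 1" by (auto simp: D_eq)
  then show ?thesis
    using sum_moebius_mu_divisors[OF g0] D_eq by (simp add: D_def)
qed

text \<open>The terms are the powers of a single \<open>w\<close> with \<open>w ^ N = 1\<close>, so
  the geometric sum vanishes unless \<open>w = 1\<close>.\<close>

lemma sum_roots_of_unity:
  assumes "N > 0"
  shows "(\<Sum>i = 1..N. exp (2 * of_real pi * \<i> * of_int j * of_nat i / of_nat N)) =
    (if int N dvd j then of_nat N else (0 :: complex))"
proof -
  define w :: complex where "w = exp (2 * of_real pi * \<i> * of_int j / of_nat N)"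
  have pow: "exp (2 * of_real pi * \<i> * of_int j * of_nat i / of_nat N) = w ^ i" for i
    unfolding w_def exp_of_nat_mult[symmetric] by (simp add: mult_ac)
  have "w ^ N = exp (2 * of_real pi * \<i> * of_int j)"
    using pow[of N] assms by simp
  also have "\<dots> = 1"
    by (auto simp: exp_eq_1)
  finally have wN: "w ^ N = 1" .
  have w1: "w = 1 \<longleftrightarrow> int N dvd j"
  proof -
    have "w = 1 \<longleftrightarrow> (\<exists>n::int. 2 * pi * of_int j / of_nat N = of_int (2 * n) * pi)"
      by (simp add: w_def exp_eq_1 Re_divide_of_nat Im_divide_of_nat)
    also have "\<dots> \<longleftrightarrow> (\<exists>n::int. real_of_int j = real_of_int (int N * n))"
      using assms by (simp add: field_simps)
    also have "\<dots> \<longleftrightarrow> int N dvd j"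
      unfolding of_int_eq_iff dvd_def ..
    finally show ?thesis .
  qed
  have "(\<Sum>i = 1..N. w ^ i) = w * (\<Sum>i<N. w ^ i)"
    by (simp add: sum_distrib_left sum.atLeast1_atMost_eq flip: power_Suc)
  also have "\<dots> = (if int N dvd j then of_nat N else 0)"
  proof (cases "w = 1")
    case False
    then show ?thesis using w1 wN by (simp add: sum_gp_strict)
  qed (use w1 in simp)
  finally show ?thesis by (simp add: pow)
qed

text \<open>The indicator of the generalized coprimality condition becomes a Moebius sum, and the
  two sums are swapped. For fixed \<open>e\<close> there remains a complete sum over residues modulo
  \<open>(k div e) ^ s\<close>, which \<open>sum_roots_of_unity\<close> evaluates.\<close>

lemma cohen_ramanujan_sum_eq:
  assumes "k > 0" and "s > 0"
  shows "cohen_ramanujan_sum s k j =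
    (\<Sum>e | e dvd k. of_int (moebius_mu e) *
       (if int ((k div e) ^ s) dvd j then of_nat ((k div e) ^ s) else 0))"
proof -
  let ?E = "\<lambda>m. exp (2 * of_real pi * \<i> * of_int j * of_nat m / of_nat (k ^ s)) :: complex"
  have inner: "(\<Sum>m\<in>{m\<in>{1..k ^ s}. e ^ s dvd m}. ?E m) =
      (if int ((k div e) ^ s) dvd j then of_nat ((k div e) ^ s) else 0)" if "e dvd k" for e
  proof -
    obtain d where d: "k = e * d" using \<open>e dvd k\<close> by blast
    with assms have pos: "e > 0" "d > 0" by auto
    have "(\<Sum>m\<in>{m\<in>{1..k ^ s}. e ^ s dvd m}. ?E m) = (\<Sum>i\<in>{1..d ^ s}. ?E (e ^ s * i))"
      using pos by (intro sum.reindex_bij_witness[where i = "\<lambda>i. e ^ s * i" and j = "\<lambda>m. m div e ^ s"])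
        (auto simp: d power_mult_distrib elim!: dvdE)
    also have "\<dots> = (\<Sum>i\<in>{1..d ^ s}. exp (2 * of_real pi * \<i> * of_int j * of_nat i / of_nat (d ^ s)))"
      using pos by (intro sum.cong refl arg_cong[where f = exp])
        (simp add: d power_mult_distrib field_simps)
    also have "\<dots> = (if int (d ^ s) dvd j then of_nat (d ^ s) else 0)"
      using pos by (intro sum_roots_of_unity) auto
    finally show ?thesis using pos by (simp add: d)
  qed
  have fin: "finite {e. e dvd k}" using assms by simp
  have "cohen_ramanujan_sum s k j =
      (\<Sum>m\<in>{1..k ^ s}. of_int (if gen_gcd s m (k ^ s) = 1 then 1 else 0) * ?E m)"
    unfolding cohen_ramanujan_sum_def
    by (intro sum.mono_neutral_cong_left) auto
  also have "\<dots> = (\<Sum>m\<in>{1..k ^ s}. \<Sum>e | e \<in> {e. e dvd k} \<and> e ^ s dvd m. of_int (moebius_mu e) * ?E m)"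
    by (simp only: sum_moebius_mu_power_divisors[OF assms, symmetric] of_int_sum sum_distrib_right mem_Collect_eq)
  also have "\<dots> = (\<Sum>e | e dvd k. \<Sum>m | m \<in> {1..k ^ s} \<and> e ^ s dvd m. of_int (moebius_mu e) * ?E m)"
    by (rule sum.swap_restrict) (use fin in auto)
  also have "\<dots> = (\<Sum>e | e dvd k. of_int (moebius_mu e) *
       (if int ((k div e) ^ s) dvd j then of_nat ((k div e) ^ s) else 0))"
    by (intro sum.cong refl) (simp only: inner sum_distrib_left[symmetric] mem_Collect_eq)
  finally show ?thesis .
qed

text \<open>For each \<open>e\<close> only the multiples \<open>j = (k div e) ^ s * i\<close>
  contribute, with \<open>i\<close> running up to \<open>e ^ s\<close>. After normalisation the
  \<open>e\<close>-term no longer involves \<open>k\<close>, so the expression is a plain divisor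
  sum.\<close>

lemma weighted_cohen_ramanujan_sum_eq:
  assumes "k > 0" and "s > 0"
  shows "1 / of_nat k ^ (s * (r + 1)) *
      (\<Sum>j = 1..k ^ s. of_nat j ^ r * cohen_ramanujan_sum s k (int j)) =
    of_real (\<Sum>e | e dvd k. of_int (moebius_mu e) *
      ((\<Sum>i = 1..e ^ s. real i ^ r) / real (e ^ s) ^ (r + 1)))"
proof -
  let ?S = "\<lambda>N. \<Sum>i = 1..N. of_nat i ^ r :: complex"
  let ?k = "of_nat k :: complex"
  have inner: "(\<Sum>j = 1..k ^ s. of_nat j ^ r * (if (k div e) ^ s dvd j then of_nat ((k div e) ^ s) else 0)) =
      ?k ^ (s * (r + 1)) * (?S (e ^ s) / of_nat (e ^ s) ^ (r + 1))" if "e dvd k" for e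
  proof -
    obtain d where d: "k = d * e" using \<open>e dvd k\<close> by (metis dvdE mult.commute)
    with assms have pos: "e > 0" "d > 0" by auto
    then have kd: "k div e = d" using d by simp
    have "(\<Sum>j = 1..k ^ s. of_nat j ^ r * (if d ^ s dvd j then of_nat (d ^ s) else 0 :: complex)) =
        (\<Sum>j | j \<in> {1..k ^ s} \<and> d ^ s dvd j. of_nat j ^ r * of_nat (d ^ s))"
      by (intro sum.mono_neutral_cong_right) auto
    also have "\<dots> = (\<Sum>i\<in>{1..e ^ s}. of_nat (d ^ s * i) ^ r * of_nat (d ^ s))"
      using pos by (intro sum.reindex_bij_witness[where i = "\<lambda>i. d ^ s * i" and j = "\<lambda>m. m div d ^ s"])
        (auto simp: d power_mult_distrib elim!: dvdE)
    also have "\<dots> = of_nat (d ^ s) ^ (r + 1) * ?S (e ^ s)"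
      by (simp add: sum_distrib_left power_mult_distrib mult_ac)
    \<comment> \<open>Since \<open>k = d * e\<close>, the factor \<open>(d ^ s) ^ (r + 1)\<close> is
      \<open>k ^ (s * (r + 1))\<close> divided by \<open>(e ^ s) ^ (r + 1)\<close>. The power of
      \<open>k\<close> later cancels the normalisation.\<close>
    also have "\<dots> = ?k ^ (s * (r + 1)) * (?S (e ^ s) / of_nat (e ^ s) ^ (r + 1))"
      using pos by (simp add: d power_add power_mult power_mult_distrib)
    finally show ?thesis unfolding kd .
  qed
  have "(\<Sum>j = 1..k ^ s. of_nat j ^ r * cohen_ramanujan_sum s k (int j)) =
      (\<Sum>j = 1..k ^ s. \<Sum>e | e dvd k. of_int (moebius_mu e) *
        (of_nat j ^ r * (if (k div e) ^ s dvd j then of_nat ((k div e) ^ s) else 0)))"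
    by (simp only: cohen_ramanujan_sum_eq[OF assms] sum_distrib_left of_nat_dvd_iff mult.left_commute)
  also have "\<dots> = (\<Sum>e | e dvd k. of_int (moebius_mu e) * (?k ^ (s * (r + 1)) *
      (?S (e ^ s) / of_nat (e ^ s) ^ (r + 1))))"
    by (subst sum.swap, intro sum.cong refl) (simp only: inner sum_distrib_left[symmetric] mem_Collect_eq)
  also have "\<dots> = ?k ^ (s * (r + 1)) * of_real (\<Sum>e | e dvd k. of_int (moebius_mu e) *
      ((\<Sum>i = 1..e ^ s. real i ^ r) / real (e ^ s) ^ (r + 1)))"
    by (simp add: sum_distrib_left mult_ac)
  finally show ?thesis using assms by simp
qed

section \<open>Average values of divisor sums\<close>

lemma card_multiples_le:
  fixes x :: real
  assumes "d > 0" and "x \<ge> 0"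
  shows "card {k. 1 \<le> k \<and> real k \<le> x \<and> d dvd k} = nat \<lfloor>x / real d\<rfloor>"
proof -
  have le_iff: "i \<le> nat \<lfloor>x / real d\<rfloor> \<longleftrightarrow> real (d * i) \<le> x" for i
  proof -
    have "i \<le> nat \<lfloor>x / real d\<rfloor> \<longleftrightarrow> real i \<le> x / real d"
      using assms by (subst le_nat_iff) (auto simp: le_floor_iff)
    then show ?thesis using assms by (simp add: pos_le_divide_eq mult.commute)
  qed
  have "bij_betw (\<lambda>i. d * i) {1..nat \<lfloor>x / real d\<rfloor>} {k. 1 \<le> k \<and> real k \<le> x \<and> d dvd k}"
    using assms by (intro bij_betwI[where g = "\<lambda>k. k div d"])
      (auto simp: le_iff elim!: dvdE simp del: of_nat_mult)
  then show ?thesis by (metis bij_betw_same_card card_atLeastAtMost diff_Suc_1)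
qed

text \<open>After swapping the sums, \<open>h d\<close> is counted once for each multiple of
  \<open>d\<close> up to \<open>x\<close>. The proportion of these multiples tends to
  \<open>1 / d\<close> and never exceeds it, so the assumed series dominates and Tannery's theorem
  allows the limit to be taken termwise.\<close>

lemma has_average_value_divisor_sum:
  fixes h :: "nat \<Rightarrow> 'a :: {real_normed_field, banach}"
  assumes "summable (\<lambda>n. norm (h (Suc n)) / real (Suc n))"
  shows "has_average_value (\<lambda>k. \<Sum>d | d dvd k. h d) (\<Sum>n. h (Suc n) / of_nat (Suc n))"
proof -
  define a where "a = (\<lambda>n x. h (Suc n) * of_real (of_int \<lfloor>x / real (Suc n)\<rfloor> / x))"
  have "((\<lambda>x. a n x) \<longlongrightarrow> h (Suc n) / of_nat (Suc n)) at_top" for n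
  proof -
    have "((\<lambda>x. of_int \<lfloor>x / real (Suc n)\<rfloor> / x) \<longlongrightarrow> inverse (real (Suc n))) at_top"
    proof -
      have "real (Suc n) > 0" by simp
      then show ?thesis by real_asymp
    qed
    then have "((\<lambda>x. a n x) \<longlongrightarrow> h (Suc n) * of_real (inverse (real (Suc n)))) at_top"
      unfolding a_def by (intro tendsto_intros)
    then show ?thesis by (simp add: divide_inverse)
  qed
  moreover have "\<forall>\<^sub>F (n, x) in at_top \<times>\<^sub>F at_top. norm (a n x) \<le> norm (h (Suc n)) / real (Suc n)"
  proof -
    have "norm (a n x) \<le> norm (h (Suc n)) / real (Suc n)" if "x > 0" for n x
    proof -
      have "of_int \<lfloor>x / real (Suc n)\<rfloor> / x \<le> 1 / real (Suc n)"
        using divide_right_mono[OF of_int_floor_le[of "x / real (Suc n)"], of x] that by simp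
      moreover have "of_int \<lfloor>x / real (Suc n)\<rfloor> / x \<ge> 0" using that by simp
      ultimately have "norm (h (Suc n)) * \<bar>of_int \<lfloor>x / real (Suc n)\<rfloor> / x\<bar> \<le> norm (h (Suc n)) * (1 / real (Suc n))"
        by (intro mult_left_mono) auto
      then show ?thesis by (simp add: a_def norm_mult norm_divide)
    qed
    then show ?thesis
      by (subst eventually_prod_filter)
        (auto intro!: exI[of _ "\<lambda>_. True"] exI[of _ "\<lambda>x. x > 0"] eventually_gt_at_top)
  qed
  ultimately have lim: "((\<lambda>x. \<Sum>n. a n x) \<longlongrightarrow> (\<Sum>n. h (Suc n) / of_nat (Suc n))) at_top"
    using tannerys_theorem[of a _ at_top, OF _ _ assms] by auto
  have eq: "(\<Sum>n. a n x) = 1 / of_real x * (\<Sum>k | 1 \<le> k \<and> real k \<le> x. \<Sum>d | d dvd k. h d)"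
    if x: "x > 0" for x
  proof -
    define N where "N = nat \<lfloor>x\<rfloor>"
    have K: "{k. 1 \<le> k \<and> real k \<le> x} = {1..N}"
      using x by (auto simp: N_def le_nat_iff le_floor_iff)
    \<comment> \<open>Divisors of a \<open>k\<close> in \<open>{1..N}\<close> lie in
      \<open>{1..N}\<close> themselves, so both sums get the same finite range and can be
      swapped.\<close>
    have "(\<Sum>k | 1 \<le> k \<and> real k \<le> x. \<Sum>d | d dvd k. h d) =
        (\<Sum>k\<in>{1..N}. \<Sum>d | d \<in> {1..N} \<and> d dvd k. h d)"
      unfolding K
    proof (intro sum.cong refl)
      fix k assume k: "k \<in> {1..N}"
      have "1 \<le> d \<and> d \<le> N" if "d dvd k" for d
        using dvd_pos_nat[OF _ that] dvd_imp_le[OF that] k by fastforce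
      then show "{d. d dvd k} = {d. d \<in> {1..N} \<and> d dvd k}" by auto
    qed
    also have "\<dots> = (\<Sum>d\<in>{1..N}. \<Sum>k | k \<in> {1..N} \<and> d dvd k. h d)"
      by (rule sum.swap_restrict[where R = "\<lambda>k d. d dvd k" and g = "\<lambda>_. h"]) simp_all
    also have "\<dots> = (\<Sum>d\<in>{1..N}. of_int \<lfloor>x / real d\<rfloor> * h d)"
    proof (intro sum.cong refl)
      fix d assume d: "d \<in> {1..N}"
      have "{k. k \<in> {1..N} \<and> d dvd k} = {k. 1 \<le> k \<and> real k \<le> x \<and> d dvd k}"
        unfolding K[symmetric] by simp
      then have "card {k. k \<in> {1..N} \<and> d dvd k} = nat \<lfloor>x / real d\<rfloor>"
        using card_multiples_le[of d x] d x by simp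
      moreover have "of_nat (nat \<lfloor>x / real d\<rfloor>) = (of_int \<lfloor>x / real d\<rfloor> :: 'a)"
        using x by (simp add: of_nat_nat)
      ultimately show "(\<Sum>k | k \<in> {1..N} \<and> d dvd k. h d) = of_int \<lfloor>x / real d\<rfloor> * h d"
        by (simp only: sum_constant)
    qed
    also have "\<dots> = (\<Sum>n<N. of_int \<lfloor>x / real (Suc n)\<rfloor> * h (Suc n))"
      by (simp add: sum.atLeast1_atMost_eq)
    finally have "1 / of_real x * (\<Sum>k | 1 \<le> k \<and> real k \<le> x. \<Sum>d | d dvd k. h d) = (\<Sum>n<N. a n x)"
      by (simp add: a_def sum_distrib_left mult_ac)
    also have "\<dots> = (\<Sum>n. a n x)"
    \<comment> \<open>Beyond \<open>N\<close> the divisor \<open>Suc n\<close> exceeds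
      \<open>x\<close>, so the floor in \<open>a n x\<close> is 0.\<close>
    proof (rule suminf_finite[symmetric])
      fix n assume "n \<notin> {..<N}"
      then have "x < real (Suc n)" unfolding N_def by (simp add: not_less) linarith
      then have "\<lfloor>x / real (Suc n)\<rfloor> = 0" using x by (simp add: floor_eq_iff)
      then show "a n x = 0" by (simp add: a_def)
    qed auto
    finally show ?thesis ..
  qed
  show ?thesis
    unfolding has_average_value_def
    by (rule Lim_transform_eventually[OF lim])
      (use eq in \<open>auto intro: eventually_mono[OF eventually_gt_at_top[of 0]]\<close>)
qed

lemma has_average_value_add:
  assumes "has_average_value f L" and "has_average_value g M"
  shows "has_average_value (\<lambda>k. f k + g k) (L + M)"
  using tendsto_add[OF assms[unfolded has_average_value_def]]
  unfolding has_average_value_def by (simp add: sum.distrib distrib_left)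

text \<open>The sum is constantly \<open>c\<close> from \<open>x = 1\<close> on, and
  \<open>c / x\<close> tends to 0. This disposes of the contribution of \<open>1 / (r + 1)\<close>
  at \<open>k = 1\<close>.\<close>

lemma has_average_value_delta_1:
  "has_average_value (\<lambda>k. if k = 1 then c else 0) (0 :: 'a :: real_normed_field)"
proof -
  have *: "(\<Sum>k | 1 \<le> k \<and> real k \<le> x. if k = 1 then c else 0) = c" if "x \<ge> 1" for x
  proof -
    have "finite {k. 1 \<le> k \<and> real k \<le> x}"
      by (rule finite_subset[of _ "{..nat \<lfloor>x\<rfloor>}"]) (auto simp: le_nat_iff le_floor_iff)
    then show ?thesis using that by (simp add: sum.delta)
  qed
  have "((\<lambda>x::real. of_real (1 / x) * c) \<longlongrightarrow> of_real 0 * c) at_top"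
    by (intro tendsto_intros) real_asymp
  then have "((\<lambda>x::real. of_real (1 / x) * c) \<longlongrightarrow> 0) at_top" by simp
  then show ?thesis
    unfolding has_average_value_def
    by (rule Lim_transform_eventually)
      (use * in \<open>auto intro: eventually_mono[OF eventually_ge_at_top[of 1]]\<close>)
qed

lemma has_average_value_cong:
  assumes "\<And>k. k > 0 \<Longrightarrow> f k = g k"
  shows "has_average_value f L \<longleftrightarrow> has_average_value g L"
  unfolding has_average_value_def using assms
  by (intro filterlim_cong refl always_eventually allI arg_cong2[where f = times] sum.cong) auto

lemma has_average_value_of_real:
  assumes "has_average_value f L"
  shows "has_average_value (\<lambda>k. of_real (f k)) (of_real L :: 'a :: real_normed_field)"
  using tendsto_of_real[where 'a = 'a, OF assms[unfolded has_average_value_def]]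
  by (simp add: has_average_value_def)

section \<open>Power sums\<close>

text \<open>A convex power lies above its tangent at \<open>a\<close>. In the induction, multiplying
  by \<open>b\<close> produces the next tangent plus a nonnegative multiple of
  \<open>(b - a)\<^sup>2\<close>.\<close>

lemma power_tangent_le:
  fixes a b :: real
  assumes "a \<ge> 0" and "b \<ge> 0"
  shows "a ^ Suc n + real (Suc n) * a ^ n * (b - a) \<le> b ^ Suc n"
proof (induction n)
  case (Suc n)
  have "b * (a ^ Suc n + real (Suc n) * a ^ n * (b - a)) \<le> b * b ^ Suc n"
    using Suc assms by (intro mult_left_mono)
  moreover have "b * (a ^ Suc n + real (Suc n) * a ^ n * (b - a)) =
      a ^ Suc (Suc n) + real (Suc (Suc n)) * a ^ Suc n * (b - a) + real (Suc n) * a ^ n * (b - a)\<^sup>2"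
    by (simp add: algebra_simps power2_eq_square)
  moreover have "real (Suc n) * a ^ n * (b - a)\<^sup>2 \<ge> 0"
    using assms by simp
  ultimately show ?case by simp
qed simp

text \<open>The tangent at \<open>N + 1\<close>, evaluated at \<open>N\<close>, bounds the increment
  of the left-hand side by that of the right-hand side.\<close>

lemma power_sum_lower:
  "real N ^ (r + 1) \<le> real (r + 1) * (\<Sum>i = 1..N. real i ^ r)"
proof (induction N)
  case (Suc N)
  have "real N ^ Suc r \<ge> real (Suc N) ^ Suc r + real (Suc r) * real (Suc N) ^ r * (real N - real (Suc N))"
    by (rule power_tangent_le) auto
  then show ?case using Suc by (simp add: algebra_simps)
qed simp

lemma power_sum_upper:
  "real (r + 1) * (\<Sum>i = 1..N. real i ^ r) \<le> real N ^ (r + 1) + real r * real N ^ r"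
proof (induction N)
  case (Suc N)
  \<comment> \<open>This is \<open>N\<close> times the tangent inequality for the
    \<open>r\<close>-th power at \<open>N\<close>, evaluated at \<open>N + 1\<close>. The case
    \<open>r = 0\<close> is separate because \<open>power_tangent_le\<close> has exponent
    \<open>Suc n\<close>.\<close>
  have "real N ^ (r + 1) + real r * real N ^ r \<le> real N * real (Suc N) ^ r"
  proof (cases r)
    case (Suc q)
    have "real N * (real N ^ Suc q + real (Suc q) * real N ^ q * (real (Suc N) - real N)) \<le>
        real N * real (Suc N) ^ Suc q"
      by (intro mult_left_mono power_tangent_le) auto
    then show ?thesis using Suc by (simp add: algebra_simps)
  qed simp
  then show ?case using Suc by (simp add: algebra_simps)
qed (simp add: power_0_left)

text \<open>For positive \<open>N\<close> this is the error of the right-endpoint Riemann sum with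
  \<open>N\<close> equal steps for the integral of the \<open>r\<close>-th power over the unit
  interval.\<close>

definition power_mean_excess :: "nat \<Rightarrow> nat \<Rightarrow> real" where
  "power_mean_excess r N = (\<Sum>i = 1..N. real i ^ r) / real N ^ (r + 1) - 1 / real (r + 1)"

lemma power_mean_excess_1: "power_mean_excess r 1 = real r / real (r + 1)"
  by (simp add: power_mean_excess_def field_simps)

lemma power_mean_excess_nonneg:
  assumes "N > 0"
  shows "power_mean_excess r N \<ge> 0"
  using power_sum_lower[of N r] assms
  by (simp add: power_mean_excess_def field_simps del: of_nat_Suc)

text \<open>Writing the constant as the value at 1 lets the tail of the final series be compared
  directly with its first term.\<close>

lemma power_mean_excess_le:
  assumes "N > 0"
  shows "power_mean_excess r N \<le> power_mean_excess r 1 / real N"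
proof -
  have "real (r + 1) * (\<Sum>i = 1..N. real i ^ r) / (real (r + 1) * real N ^ (r + 1)) \<le>
      (real N ^ (r + 1) + real r * real N ^ r) / (real (r + 1) * real N ^ (r + 1))"
    by (intro divide_right_mono power_sum_upper) auto
  also have "\<dots> = 1 / real (r + 1) + power_mean_excess r 1 / real N"
    using assms unfolding power_mean_excess_1
    by (simp add: add_divide_distrib del: of_nat_Suc of_nat_add)
  finally show ?thesis by (simp add: power_mean_excess_def del: of_nat_Suc of_nat_add)
qed

text \<open>Any bound below 1 serves the positivity argument; \<open>2 / 3\<close> is a simple one
  close to the true value \<open>pi\<^sup>2 / 6 - 1\<close>.\<close>

lemma inverse_square_tail_bound:
  shows summable_inverse_square_tail: "summable (\<lambda>n. 1 / (real (Suc (Suc n)))\<^sup>2)"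
    and suminf_inverse_square_tail: "(\<Sum>n. 1 / (real (Suc (Suc n)))\<^sup>2) \<le> 2 / 3"
proof -
  \<comment> \<open>With \<open>m = n + 2\<close> this is \<open>1 / (m - 1/2)\<close>, and the
    telescoped total is \<open>u 0 = 2 / 3\<close>.\<close>
  define u where "u = (\<lambda>n. 1 / (real n + 3 / 2))"
  have "u \<longlonglongrightarrow> 0" unfolding u_def by real_asymp
  then have sums: "(\<lambda>n. u n - u (Suc n)) sums (2 / 3)"
    using telescope_sums'[of u 0] by (simp add: u_def)
  \<comment> \<open>\<open>1 / m\<^sup>2 \<le> 1 / (m\<^sup>2 - 1/4)\<close>, and the right-hand side telescopes\<close>
  have le: "1 / (real (Suc (Suc n)))\<^sup>2 \<le> u n - u (Suc n)" for n
  proof -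
    have "u n - u (Suc n) = 1 / ((real n + 2)\<^sup>2 - 1 / 4)"
      by (simp add: u_def field_simps power2_eq_square)
    also have "\<dots> \<ge> 1 / (real n + 2)\<^sup>2"
      by (intro divide_left_mono) (auto simp: power2_eq_square field_simps intro!: mult_pos_pos add_pos_nonneg)
    finally show ?thesis by (simp add: add_ac)
  qed
  show *: "summable (\<lambda>n. 1 / (real (Suc (Suc n)))\<^sup>2)"
    by (rule summable_comparison_test_ev[OF _ sums_summable[OF sums]]) (use le in simp)
  show "(\<Sum>n. 1 / (real (Suc (Suc n)))\<^sup>2) \<le> 2 / 3"
    using suminf_le[OF le * sums_summable[OF sums]] sums_unique[OF sums] by simp
qed

section \<open>The average of the weighted sums\<close>

theorem theorem3p3:
  fixes s r :: nat
  assumes "s \<ge> 1" and "r \<ge> 1"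
  shows "\<exists>L :: real. L > 0 \<and>
    has_average_value
      (\<lambda>k. 1 / of_nat k ^ (s * (r + 1)) *
           (\<Sum>j = 1..k ^ s. of_nat j ^ r * cohen_ramanujan_sum s k (int j)))
      (complex_of_real L)"
proof -
  define c where "c = power_mean_excess r 1"
  have c_pos: "c > 0" unfolding c_def power_mean_excess_1 using assms by simp
  define h where "h = (\<lambda>e. of_int (moebius_mu e) * power_mean_excess r (e ^ s))"
  have h_1: "h 1 = c" by (simp add: h_def c_def)
  have h_bound: "\<bar>h (Suc n) / real (Suc n)\<bar> \<le> c / (real (Suc n))\<^sup>2" for n
  proof -
    have "\<bar>h (Suc n)\<bar> \<le> 1 * \<bar>power_mean_excess r (Suc n ^ s)\<bar>"
      unfolding h_def abs_mult using abs_moebius_mu_le[of "Suc n"]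
      by (intro mult_right_mono) linarith+
    also have "\<dots> = power_mean_excess r (Suc n ^ s)"
      using power_mean_excess_nonneg[of "Suc n ^ s" r] by simp
    also have "\<dots> \<le> c / real (Suc n ^ s)"
      unfolding c_def by (rule power_mean_excess_le) simp
    \<comment> \<open>Replacing \<open>Suc n ^ s\<close> by \<open>Suc n\<close> gives one
      inverse-square estimate for all \<open>s\<close>, already strong enough at
      \<open>s = 1\<close>.\<close>
    also have "\<dots> \<le> c / real (Suc n)"
      using c_pos self_le_power[of "real (Suc n)" s] assms by (intro divide_left_mono) auto
    finally have "\<bar>h (Suc n)\<bar> / real (Suc n) \<le> c / real (Suc n) / real (Suc n)"
      by (rule divide_right_mono) simp
    then show ?thesis by (simp add: power2_eq_square)
  qed
  have tail_summable: "summable (\<lambda>n. c * (1 / (real (Suc (Suc n)))\<^sup>2))"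
    by (intro summable_mult summable_inverse_square_tail)
  have tail_bound: "norm (h (Suc (Suc n)) / real (Suc (Suc n))) \<le> c * (1 / (real (Suc (Suc n)))\<^sup>2)" for n
    using h_bound[of "Suc n"] by simp
  have "summable (\<lambda>n. norm (h (Suc (Suc n)) / real (Suc (Suc n))))"
    by (rule summable_comparison_test_ev[OF _ tail_summable]) (use tail_bound in simp)
  then have summable: "summable (\<lambda>n. norm (h (Suc n) / real (Suc n)))"
    by (subst (asm) summable_Suc_iff)
  define L where "L = (\<Sum>n. h (Suc n) / real (Suc n))"
  have "L - c = (\<Sum>n. h (Suc (Suc n)) / real (Suc (Suc n)))"
    using suminf_split_head[OF summable_norm_cancel[OF summable]] h_1 by (simp add: L_def)
  also have "norm \<dots> \<le> (\<Sum>n. c * (1 / (real (Suc (Suc n)))\<^sup>2))"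
    by (rule norm_suminf_le[OF tail_bound tail_summable])
  also have "\<dots> = c * (\<Sum>n. 1 / (real (Suc (Suc n)))\<^sup>2)"
    by (rule suminf_mult[OF summable_inverse_square_tail])
  also have "\<dots> \<le> c * (2 / 3)"
    using c_pos suminf_inverse_square_tail by (intro mult_left_mono) auto
  \<comment> \<open>The distance from \<open>L\<close> to \<open>c\<close> is at most
    \<open>2 * c / 3\<close>, so \<open>L\<close> is at least \<open>c / 3\<close>.\<close>
  finally have "L > 0" using c_pos by (simp add: abs_if split: if_splits)

  have "has_average_value (\<lambda>k. \<Sum>e | e dvd k. h e) L"
    unfolding L_def using summable by (intro has_average_value_divisor_sum) (simp add: norm_divide)
  from has_average_value_add[OF this has_average_value_delta_1[of "1 / real (r + 1)"]]
  have "has_average_value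
      (\<lambda>k. complex_of_real ((\<Sum>e | e dvd k. h e) + (if k = 1 then 1 / real (r + 1) else 0))) (of_real L)"
    by (intro has_average_value_of_real) simp
  \<comment> \<open>The constant subtracted in \<open>power_mean_excess\<close> returns multiplied
    by the divisor sum of \<open>moebius_mu\<close>, which is nonzero only at
    \<open>k = 1\<close>.\<close>
  moreover have "of_real ((\<Sum>e | e dvd k. h e) + (if k = 1 then 1 / real (r + 1) else 0)) =
      1 / of_nat k ^ (s * (r + 1)) *
        (\<Sum>j = 1..k ^ s. of_nat j ^ r * cohen_ramanujan_sum s k (int j))" if "k > 0" for k
  proof -
    have "(\<Sum>e | e dvd k. of_int (moebius_mu e) * ((\<Sum>i = 1..e ^ s. real i ^ r) / real (e ^ s) ^ (r + 1))) =
        (\<Sum>e | e dvd k. h e + of_int (moebius_mu e) * (1 / real (r + 1)))"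
      by (intro sum.cong refl) (simp add: h_def power_mean_excess_def algebra_simps)
    also have "\<dots> = (\<Sum>e | e dvd k. h e) + of_int (\<Sum>e | e dvd k. moebius_mu e) * (1 / real (r + 1))"
      by (simp only: sum.distrib sum_distrib_right of_int_sum)
    also have "\<dots> = (\<Sum>e | e dvd k. h e) + (if k = 1 then 1 / real (r + 1) else 0)"
      by (simp add: sum_moebius_mu_divisors[OF that])
    finally show ?thesis
      using weighted_cohen_ramanujan_sum_eq[of k s r] that assms by simp
  qed
  ultimately have "has_average_value
      (\<lambda>k. 1 / of_nat k ^ (s * (r + 1)) *
           (\<Sum>j = 1..k ^ s. of_nat j ^ r * cohen_ramanujan_sum s k (int j))) (complex_of_real L)"
    by (subst (asm) has_average_value_cong)
  with \<open>L > 0\<close> show ?thesis by blast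
qed

end
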